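(* Let $X$ be a Hausdorff locally convex topological vector space. Suppose that $f:X\to\mathbb{R}\cup\{+\infty\}$ is Lipschitz on $\operatorname{dom} f$ with seminorm $p$. Then $f$ is $e$-convex with $$e(x,y)=2p(x-y)\qquad\text{for all }x,y\in\operatorname{dom} f.$$
   Context: For $f:X\to\mathbb{R}\cup\{+\infty\}$, $\operatorname{dom} f=\{x\in X: f(x)<+\infty\}$. $f$ is Lipschitz on a set $A\subset\operatorname{dom} f$ with seminorm $p$ if $p$ is a continuous seminorm on $X$ such that $|f(x)-f(y)|\le p(x-y)$ for all $x,y\in A$. An error function is a map $e:X\times X\to\mathbb{R}\cup\{+\infty\}$ that is nonnegative, symmetric ($e(x,y)=e(y,x)$), and has nonempty domain $\operatorname{dom} e=\{(x,y): e(x,y)<+\infty\}$. Given an error function $e$ with $\operatorname{dom} f\times\operatorname{dom} f\subset\operatorname{dom} e$, $f$ is called $e$-convex if $f(tx+(1-t)y)\le tf(x)+(1-t)f(y)+t(1-t)e(x,y)$ for all $x,y\in X$ and $t\in\,]0,1[$.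
   Formalization: The formal statement adds that dom f is convex; without it the claim fails, e.g. f = 0 on {0,1} and +∞ elsewhere on the real line with p = |·|, and every e-convex f (with e finite on dom f × dom f) has a convex domain. *)

theory Defs
  imports "HOL-Analysis.Analysis"
begin

class hausdorff_locally_convex_space = real_vector + topological_ab_group_add + t2_space +
  assumes tendsto_scaleR_Pair:
    "LIM z (nhds c \<times>\<^sub>F nhds x). fst z *\<^sub>R snd z :> nhds (c *\<^sub>R x)"
    and convex_open_nbhd_0:
    "open U \<Longrightarrow> 0 \<in> U \<Longrightarrow>
       \<exists>V. open V \<and> 0 \<in> V \<and> V \<subseteq> U \<and>
           (\<forall>x\<in>V. \<forall>y\<in>V. \<forall>u\<ge>0. \<forall>v\<ge>0. u + v = 1 \<longrightarrow> u *\<^sub>R x + v *\<^sub>R y \<in> V)"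

text \<open>The last condition on \<open>V\<close> is \<open>convex V\<close>, unfolded because that constant is not
  available inside the class specification.\<close>

instance real_normed_vector < hausdorff_locally_convex_space
proof
  fix c :: real and x :: 'a
  show "LIM z (nhds c \<times>\<^sub>F nhds x). fst z *\<^sub>R snd z :> nhds (c *\<^sub>R x)"
    by (intro tendsto_scaleR filterlim_fst filterlim_snd)
next
  fix U :: "'a set"
  assume "open U" "0 \<in> U"
  then obtain e where "e > 0" "ball 0 e \<subseteq> U"
    using open_contains_ball by blast
  then show "\<exists>V. open V \<and> 0 \<in> V \<and> V \<subseteq> U \<and>
      (\<forall>x\<in>V. \<forall>y\<in>V. \<forall>u\<ge>0. \<forall>v\<ge>0. u + v = 1 \<longrightarrow> u *\<^sub>R x + v *\<^sub>R y \<in> V)"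
    using convex_ball[of 0 e] unfolding convex_def
    by (intro exI[of _ "ball 0 e"]) auto
qed

definition seminorm :: "('a::real_vector \<Rightarrow> real) \<Rightarrow> bool" where
  "seminorm p \<longleftrightarrow>
     (\<forall>x. 0 \<le> p x) \<and> (\<forall>x y. p (x + y) \<le> p x + p y) \<and> (\<forall>c x. p (c *\<^sub>R x) = \<bar>c\<bar> * p x)"

text \<open>Functions into the reals extended by plus infinity are modelled as functions into
  \<^typ>\<open>ereal\<close> that never take the value \<open>-\<infinity>\<close>.\<close>

definition no_minus_infinity :: "('a \<Rightarrow> ereal) \<Rightarrow> bool" where
  "no_minus_infinity f \<longleftrightarrow> (\<forall>x. f x \<noteq> -\<infinity>)"

definition effective_domain :: "('a \<Rightarrow> ereal) \<Rightarrow> 'a set" where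
  "effective_domain f = {x. f x < \<infinity>}"

definition lipschitz_on_with_seminorm ::
    "'a::hausdorff_locally_convex_space set \<Rightarrow> ('a \<Rightarrow> ereal) \<Rightarrow> ('a \<Rightarrow> real) \<Rightarrow> bool" where
  "lipschitz_on_with_seminorm A f p \<longleftrightarrow>
     A \<subseteq> effective_domain f \<and> seminorm p \<and> continuous_on UNIV p \<and>
     (\<forall>x\<in>A. \<forall>y\<in>A. \<bar>f x - f y\<bar> \<le> ereal (p (x - y)))"

definition error_function :: "('a \<times> 'a \<Rightarrow> ereal) \<Rightarrow> bool" where
  "error_function e \<longleftrightarrow>
     (\<forall>x y. 0 \<le> e (x, y)) \<and> (\<forall>x y. e (x, y) = e (y, x)) \<and> effective_domain e \<noteq> {}"

definition e_convex :: "('a::real_vector \<times> 'a \<Rightarrow> ereal) \<Rightarrow> ('a \<Rightarrow> ereal) \<Rightarrow> bool" where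
  "e_convex e f \<longleftrightarrow>
     error_function e \<and> effective_domain f \<times> effective_domain f \<subseteq> effective_domain e \<and>
     (\<forall>x y. \<forall>t\<in>{0<..<1}.
        f (t *\<^sub>R x + (1 - t) *\<^sub>R y)
          \<le> ereal t * f x + ereal (1 - t) * f y + ereal (t * (1 - t)) * e (x, y))"

text \<open>The error function \<open>2p(x - y)\<close> is only prescribed on the effective domain of \<open>f\<close>;
  using it everywhere is one admissible choice.\<close>

lemma error_function_seminorm:
  assumes "seminorm p"
  shows "error_function (\<lambda>(x, y). ereal (2 * p (x - y)))"
proof -
  have "p (x - y) = p (y - x)" for x y
  proof -
    have "p ((-1) *\<^sub>R (y - x)) = \<bar>-1\<bar> * p (y - x)"
      using assms unfolding seminorm_def by blast
    then show ?thesis by simp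
  qed
  then show ?thesis
    using assms by (simp add: error_function_def effective_domain_def seminorm_def)
qed

text \<open>An \<open>e\<close>-convex function has a convex effective domain, because \<open>e\<close> is finite on pairs of
  points of that domain. Lipschitz continuity on the effective domain does not imply this:
  consider the function on the reals that is \<open>0\<close> at \<open>0\<close> and \<open>1\<close> and \<open>\<infinity>\<close> elsewhere.\<close>

lemma e_convex_imp_convex_effective_domain:
  assumes "e_convex e f"
  shows "convex (effective_domain f)"
  unfolding convex_alt
proof (intro ballI allI impI)
  fix x y and u :: real
  assume xy: "x \<in> effective_domain f" "y \<in> effective_domain f" and u: "0 \<le> u \<and> u \<le> 1"
  show "(1 - u) *\<^sub>R x + u *\<^sub>R y \<in> effective_domain f"
  proof (cases "u = 0 \<or> u = 1")
    case True
    then show ?thesis using xy by auto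
  next
    case False
    then have t: "1 - u \<in> {0<..<1}" using u by auto
    have "(x, y) \<in> effective_domain e"
      using assms xy unfolding e_convex_def by blast
    then have fin: "f x < \<infinity>" "f y < \<infinity>" "e (x, y) < \<infinity>"
      using xy by (simp_all add: effective_domain_def)
    have "f ((1 - u) *\<^sub>R x + u *\<^sub>R y)
        \<le> ereal (1 - u) * f x + ereal u * f y + ereal ((1 - u) * u) * e (x, y)"
      using assms t unfolding e_convex_def by fastforce
    also have "\<dots> < \<infinity>"
      using fin t by (cases "f x"; cases "f y"; cases "e (x, y)") auto
    finally show ?thesis by (simp add: effective_domain_def)
  qed
qed

end

(* With z = t x + (1 - t) y we have z - x = (t - 1)(x - y) and z - y = t (x - y), so the Lipschitz
   bounds are f z - f x <= (1 - t) p (x - y) and f z - f y <= t p (x - y). Their convex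
   combination with weights t and 1 - t has the error t (1 - t) 2 p (x - y). *)
theory Submission
  imports Defs
begin

theorem proposition7:
  fixes f :: "'a::hausdorff_locally_convex_space \<Rightarrow> ereal"
    and p :: "'a \<Rightarrow> real"
    and e :: "'a \<times> 'a \<Rightarrow> ereal"
  assumes "no_minus_infinity f"
    and "convex (effective_domain f)"
    and "lipschitz_on_with_seminorm (effective_domain f) f p"
    and "error_function e"
    and "\<And>x y. x \<in> effective_domain f \<Longrightarrow> y \<in> effective_domain f \<Longrightarrow>
           e (x, y) = ereal (2 * p (x - y))"
  shows "e_convex e f"
proof -
  have sn: "seminorm p"
    and lip: "\<And>x y. x \<in> effective_domain f \<Longrightarrow> y \<in> effective_domain f \<Longrightarrow>
        \<bar>f x - f y\<bar> \<le> ereal (p (x - y))"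
    using assms(3) by (auto simp: lipschitz_on_with_seminorm_def)
  have hom: "p (c *\<^sub>R v) = \<bar>c\<bar> * p v" for c v
    using sn by (simp add: seminorm_def)
  \<comment> \<open>Real representatives turn the \<open>ereal\<close> inequalities into real
    arithmetic, where subtraction is safe.\<close>
  have fin: "\<exists>r. f x = ereal r" if "x \<in> effective_domain f" for x
    using that assms(1) by (cases "f x") (auto simp: effective_domain_def no_minus_infinity_def)
  have "f (t *\<^sub>R x + (1 - t) *\<^sub>R y)
      \<le> ereal t * f x + ereal (1 - t) * f y + ereal (t * (1 - t)) * e (x, y)"
    if t: "0 < t" "t < 1" for x y t
  proof (cases "x \<in> effective_domain f \<and> y \<in> effective_domain f")
    case True
    define z where "z = t *\<^sub>R x + (1 - t) *\<^sub>R y"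
    \<comment> \<open>Convexity of the domain enters here: the Lipschitz bound says nothing about
      \<open>z\<close> until \<open>z\<close> is known to lie in the domain.\<close>
    have z: "z \<in> effective_domain f"
      unfolding z_def using assms(2) True t by (intro convexD) auto
    obtain a b c where abc: "f x = ereal a" "f y = ereal b" "f z = ereal c"
      using fin True z by meson
    have "z - x = (t - 1) *\<^sub>R (x - y)" "z - y = t *\<^sub>R (x - y)"
      by (simp_all add: z_def algebra_simps)
    then have "p (z - x) = (1 - t) * p (x - y)" "p (z - y) = t * p (x - y)"
      using t by (simp_all add: hom)
    \<comment> \<open>Only the upper half of each absolute value bound is kept.\<close>
    then have "c - a \<le> (1 - t) * p (x - y)" "c - b \<le> t * p (x - y)"
      using lip[OF z, of x] lip[OF z, of y] True by (auto simp: abc)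
    then have "t * (c - a) + (1 - t) * (c - b)
        \<le> t * ((1 - t) * p (x - y)) + (1 - t) * (t * p (x - y))"
      using t by (intro add_mono mult_left_mono) auto
    then have "c \<le> t * a + (1 - t) * b + t * (1 - t) * (2 * p (x - y))"
      by (simp add: algebra_simps)
    then show ?thesis
      using True by (simp add: assms(5) abc flip: z_def)
  next
    \<comment> \<open>The right-hand side is \<infinity>: both weights are strictly positive, so an
      infinite value of \<open>f\<close> survives scaling, and in \<open>ereal\<close> a summand
      \<infinity> absorbs all others, whatever \<open>e (x, y)\<close> is.\<close>
    case False
    then have "f x = \<infinity> \<or> f y = \<infinity>"
      by (auto simp: effective_domain_def)
    then show ?thesis
      using t by auto
  qed
  moreover have "effective_domain f \<times> effective_domain f \<subseteq> effective_domain e"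
    using assms(5) by (auto simp: effective_domain_def)
  ultimately show ?thesis
    using assms(4) by (simp add: e_convex_def)
qed

end
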